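(* Let $l_\infty$ be an arbitrary line of $\mathrm{PG}(2,3)$, let $\varphi$ be the Veronese mapping from the points of $\mathrm{PG}(2,3)$ to the points of $\mathrm{PG}(5,3)$, let $\Gamma_\infty := l_\infty^{\varphi}$ be the image of $l_\infty$ (a planar quadrangle), and let $\Delta_\infty$ be its diagonal triangle. Let $\mathcal{K} := (\operatorname{im}\varphi \setminus \Gamma_\infty)\cup \Delta_\infty$ be the set of points of $\mathrm{PG}(5,3)$ obtained from the Veronese surface $\operatorname{im}\varphi$ by replacing $\Gamma_\infty$ with $\Delta_\infty$. Then: (i) $\#(\mathcal{H}\cap\mathcal{K})\in\{0,3,6\}$ for every hyperplane $\mathcal{H}$ of $\mathrm{PG}(5,3)$; (ii) $\#\mathcal{K}=12$.
   Context: Let $F=\mathrm{GF}(3)$, let $\mathbf{V}$ be a $3$-dimensional $F$-vector space and $\mathbf{W}=\mathbf{V}\vee\mathbf{V}$ its symmetric tensor square, which has dimension $6$. $\mathrm{PG}(2,3)$ and $\mathrm{PG}(5,3)$ denote the projective spaces on $\mathbf{V}$ and $\mathbf{W}$; their points are the one-dimensional subspaces. The Veronese mapping is $\varphi: F\mathbf{a}\mapsto F(\mathbf{a}\vee\mathbf{a})$; in suitable coordinates, $F(x_0,x_1,x_2)\mapsto F(x_0^2,x_0x_1,x_0x_2,x_1^2,x_1x_2,x_2^2)$. It is injective, and its image $\operatorname{im}\varphi$ is called the Veronese surface. The image under $\varphi$ of a line of $\mathrm{PG}(2,3)$ (viewed as its set of four points) is a non-degenerate conic in a plane of $\mathrm{PG}(5,3)$,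 i.e. four coplanar points no three of which are collinear (a planar quadrangle). The diagonal triangle of a quadrangle $\{A,B,C,D\}$ in a projective plane of order $3$ is the set of its three diagonal points $AB\cap CD$, $AC\cap BD$, $AD\cap BC$; these are not collinear. *)

theory Defs
  imports "HOL-Analysis.Analysis"
begin

text \<open>
  The points of the projective space on a coordinate space over a field are its one-dimensional
  linear subspaces. A projective subspace is represented by the set of points that it contains,
  so that lines and hyperplanes are sets of points and intersect as such.
\<close>

definition pg_points :: "('f::field ^ 'n) set set" where
  "pg_points = {P. vec.subspace P \<and> vec.dim P = 1}"

definition pg_of :: "('f::field ^ 'n) set \<Rightarrow> ('f ^ 'n) set set" where
  "pg_of U = {P \<in> pg_points. P \<subseteq> U}"

definition pg_line :: "('f::field ^ 'n) set set \<Rightarrow> bool" where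
  "pg_line l \<longleftrightarrow> (\<exists>U. vec.subspace U \<and> vec.dim U = 2 \<and> l = pg_of U)"

definition pg_hyperplane :: "('f::field ^ 'n) set set \<Rightarrow> bool" where
  "pg_hyperplane H \<longleftrightarrow> (\<exists>U. vec.subspace U \<and> vec.dim U + 1 = CARD('n) \<and> H = pg_of U)"

definition pg_join :: "('f::field ^ 'n) set \<Rightarrow> ('f ^ 'n) set \<Rightarrow> ('f ^ 'n) set set" where
  "pg_join A B = pg_of (vec.span (A \<union> B))"

text \<open>For a planar quadrangle these are the three diagonal points.\<close>

definition diagonal_triangle :: "('f::field ^ 'n) set set \<Rightarrow> ('f ^ 'n) set set" where
  "diagonal_triangle Q =
     {P. \<exists>A B C D. Q = {A, B, C, D} \<and> distinct [A, B, C, D] \<and> P \<in> pg_join A B \<inter> pg_join C D}"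

text \<open>
  The symmetric tensor square of \<open>F\<^sup>3\<close> over a field in which \<open>2\<close> is invertible, as \<open>F\<^sup>6\<close>. With
  \<open>e\<^sub>1, e\<^sub>2, e\<^sub>3\<close> the standard basis of \<open>F\<^sup>3\<close> and \<open>e\<^sub>i \<or> e\<^sub>j\<close> the symmetric product, coordinates refer to
  the basis \<open>e\<^sub>1 \<or> e\<^sub>1, 2(e\<^sub>1 \<or> e\<^sub>2), 2(e\<^sub>1 \<or> e\<^sub>3), e\<^sub>2 \<or> e\<^sub>2, 2(e\<^sub>2 \<or> e\<^sub>3), e\<^sub>3 \<or> e\<^sub>3\<close>. The factors \<open>2\<close> give squares the
  coordinates stated in \<open>sym_prod_self\<close>. The universal property of the symmetric square is
  \<open>sym_prod_universal\<close>.
\<close>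

definition sym_prod :: "'f::field ^ 3 \<Rightarrow> 'f ^ 3 \<Rightarrow> 'f ^ 6" where
  "sym_prod a b = vector
     [a$1 * b$1, (a$1 * b$2 + a$2 * b$1) / 2, (a$1 * b$3 + a$3 * b$1) / 2,
      a$2 * b$2, (a$2 * b$3 + a$3 * b$2) / 2, a$3 * b$3]"

text \<open>
  If \<open>P\<close> is spanned by \<open>a\<close>, then the vectors \<open>x \<or> x\<close> with \<open>x \<in> P\<close> are multiples of \<open>a \<or> a\<close>
  and include it, so this is the point spanned by \<open>a \<or> a\<close>; see \<open>veronese_span\<close>.
\<close>

definition veronese :: "('f::field ^ 3) set \<Rightarrow> ('f ^ 6) set" where
  "veronese P = vec.span ((\<lambda>x. sym_prod x x) ` P)"

lemma vector_6:
  fixes a b c d e f :: "'a::zero"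
  shows "(vector [a, b, c, d, e, f] :: 'a ^ 6) $ 1 = a"
    and "(vector [a, b, c, d, e, f] :: 'a ^ 6) $ 2 = b"
    and "(vector [a, b, c, d, e, f] :: 'a ^ 6) $ 3 = c"
    and "(vector [a, b, c, d, e, f] :: 'a ^ 6) $ 4 = d"
    and "(vector [a, b, c, d, e, f] :: 'a ^ 6) $ 5 = e"
    and "(vector [a, b, c, d, e, f] :: 'a ^ 6) $ 6 = f"
  unfolding vector_def by simp_all

lemma forall_6: "(\<forall>i::6. P i) \<longleftrightarrow> P 1 \<and> P 2 \<and> P 3 \<and> P 4 \<and> P 5 \<and> P 6"
proof -
  have "i = 1 \<or> i = 2 \<or> i = 3 \<or> i = 4 \<or> i = 5 \<or> i = 6" for i :: 6
  proof (induct i)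
    case (of_int z)
    then have "z = 0 \<or> z = 1 \<or> z = 2 \<or> z = 3 \<or> z = 4 \<or> z = 5" by fastforce
    then show ?case by auto
  qed
  then show ?thesis by metis
qed

lemma sym_prod_self:
  fixes x :: "'f::field ^ 3"
  assumes "(2::'f) \<noteq> 0"
  shows "sym_prod x x =
    vector [(x$1)\<^sup>2, x$1 * x$2, x$1 * x$3, (x$2)\<^sup>2, x$2 * x$3, (x$3)\<^sup>2]"
  using assms
  by (simp add: sym_prod_def vec_eq_iff forall_6 vector_6 power2_eq_square field_simps)

lemma veronese_span:
  fixes a :: "'f::field ^ 3"
  shows "veronese (vec.span {a}) = vec.span {sym_prod a a}"
proof -
  have "sym_prod (k *s a) (k *s a) = k\<^sup>2 *s sym_prod a a" for k
    by (simp add: sym_prod_def vec_eq_iff forall_6 vector_6 power2_eq_square algebra_simps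
        add_divide_distrib)
  then have "(\<lambda>x. sym_prod x x) ` vec.span {a} \<subseteq> vec.span {sym_prod a a}"
    by (auto simp: vec.span_singleton)
  then have "veronese (vec.span {a}) \<subseteq> vec.span {sym_prod a a}"
    unfolding veronese_def by (intro vec.span_minimal vec.subspace_span)
  moreover have "vec.span {sym_prod a a} \<subseteq> veronese (vec.span {a})"
    unfolding veronese_def by (intro vec.span_mono) (simp add: vec.span_base)
  ultimately show ?thesis by (rule subset_antisym)
qed

lemma sym_prod_universal:
  fixes scale :: "'f::field \<Rightarrow> 'u::ab_group_add \<Rightarrow> 'u" and B :: "'f ^ 3 \<Rightarrow> 'f ^ 3 \<Rightarrow> 'u"
  assumes two: "(2::'f) \<noteq> 0"
    and lin: "\<And>a. Vector_Spaces.linear (*s) scale (B a)"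
    and sym: "\<And>a b. B a b = B b a"
  shows "\<exists>!g. Vector_Spaces.linear (*s) scale g \<and> (\<forall>a b. g (sym_prod a b) = B a b)"
proof -
  interpret U: vector_space scale
    using lin[of 0] by (simp add: Vector_Spaces.linear_def)
  define e :: "3 \<Rightarrow> 'f ^ 3" where "e i = axis i 1" for i
  have ex: "x = x$1 *s e 1 + x$2 *s e 2 + x$3 *s e 3" for x
    by (simp add: e_def vec_eq_iff forall_3 axis_def)
  have addr: "B a (x + y) = B a x + B a y" and scr: "B a (k *s x) = scale k (B a x)" for a x y k
    using lin[of a] by (simp_all add: Vector_Spaces.linear_iff)
  have addl: "B (x + y) a = B x a + B y a" and scl: "B (k *s x) a = scale k (B x a)" for a x y k
    by (simp_all add: sym[of _ a] addr scr)
  have Bex: "B a b =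
      scale (a$1 * b$1) (B (e 1) (e 1)) + scale (a$1 * b$2 + a$2 * b$1) (B (e 1) (e 2))
      + scale (a$1 * b$3 + a$3 * b$1) (B (e 1) (e 3)) + scale (a$2 * b$2) (B (e 2) (e 2))
      + scale (a$2 * b$3 + a$3 * b$2) (B (e 2) (e 3)) + scale (a$3 * b$3) (B (e 3) (e 3))" for a b
    by (subst ex[of a], subst ex[of b])
      (simp add: addl addr scl scr U.scale_left_distrib U.scale_right_distrib
        sym[of "e 2" "e 1"] sym[of "e 3" "e 1"] sym[of "e 3" "e 2"] mult.commute)
  define g where "g w =
      scale (w$1) (B (e 1) (e 1)) + scale (2 * w$2) (B (e 1) (e 2))
      + scale (2 * w$3) (B (e 1) (e 3)) + scale (w$4) (B (e 2) (e 2))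
      + scale (2 * w$5) (B (e 2) (e 3)) + scale (w$6) (B (e 3) (e 3))" for w :: "'f ^ 6"
  have "Vector_Spaces.linear (*s) scale g"
    unfolding Vector_Spaces.linear_iff
    using vec.vector_space_axioms U.vector_space_axioms
    by (simp add: g_def U.scale_left_distrib U.scale_right_distrib algebra_simps)
  moreover have "g (sym_prod a b) = B a b" for a b
    using two by (simp add: g_def Bex[of a b] sym_prod_def vector_6 del: distrib_left_numeral)
  moreover have "h = g" if h: "Vector_Spaces.linear (*s) scale h"
    and hB: "\<forall>a b. h (sym_prod a b) = B a b" for h
  proof
    fix w :: "'f ^ 6"
    have "w = w$1 *s sym_prod (e 1) (e 1) + (2 * w$2) *s sym_prod (e 1) (e 2)
      + (2 * w$3) *s sym_prod (e 1) (e 3) + w$4 *s sym_prod (e 2) (e 2)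
      + (2 * w$5) *s sym_prod (e 2) (e 3) + w$6 *s sym_prod (e 3) (e 3)"
      using two by (simp add: sym_prod_def e_def vec_eq_iff forall_6 vector_6 axis_def)
    then have "h w = h (w$1 *s sym_prod (e 1) (e 1) + (2 * w$2) *s sym_prod (e 1) (e 2)
      + (2 * w$3) *s sym_prod (e 1) (e 3) + w$4 *s sym_prod (e 2) (e 2)
      + (2 * w$5) *s sym_prod (e 2) (e 3) + w$6 *s sym_prod (e 3) (e 3))"
      by (rule arg_cong)
    also have "\<dots> = g w"
      using h hB by (simp add: Vector_Spaces.linear_iff g_def)
    finally show "h w = g w" .
  qed
  ultimately show ?thesis by blast
qed

lemma two_neq_zero_if_card_3:
  assumes "CARD('f::field) = 3"
  shows "(2::'f) \<noteq> 0"
proof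
  assume two: "(2::'f) = 0"
  have "\<exists>c::'f. c \<notin> {0, 1}"
  proof (rule ccontr)
    assume "\<not> ?thesis"
    then have "(UNIV :: 'f set) = {0, 1}" by auto
    with assms show False by (metis card_2_iff numeral_eq_iff semiring_norm(89) zero_neq_one)
  qed
  then obtain c :: 'f where c: "c \<noteq> 0" "c \<noteq> 1" by auto
  have fin: "finite (UNIV :: 'f set)"
    using assms by (metis card.infinite zero_neq_numeral)
  have "c + 1 \<noteq> 0"
  proof
    assume "c + 1 = 0"
    then have "c = -1" by (simp add: eq_neg_iff_add_eq_0)
    moreover have "(-1::'f) = 1" using two by (simp add: neg_eq_iff_add_eq_0)
    ultimately show False using c by simp
  qed
  then have "card {0, 1, c, c + 1} = 4" using c by auto
  then show False using assms card_mono[OF fin, of "{0, 1, c, c + 1}"] by simp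
qed

end

theory Submission
  imports Defs
begin

text \<open>
  A linear bijection of \<open>F\<^sup>3\<close> moving the plane \<open>x\<^sub>3 = 0\<close> onto the plane of \<open>l\<^sub>\<infinity>\<close> induces a linear bijection
  of the symmetric square, so it suffices to study explicit vectors: \<open>\<K>\<close> consists of the nine squares
  \<open>(a, b, 1) \<or> (a, b, 1)\<close> and of three diagonal points. A hyperplane is a non-zero functional \<open>c\<close>,
  whose restriction to the nine affine points is a polynomial \<open>q(a, b)\<close> of degree at most 2 and whose
  values at the diagonal points are \<open>c\<^sub>1 + c\<^sub>4\<close> and \<open>c\<^sub>1 \<plusminus> c\<^sub>2 - c\<^sub>4\<close>. Since \<open>1 - x\<^sup>2\<close> is the indicator of
  \<open>x = 0\<close> in \<open>GF(3)\<close> and the squares of the twelve values sum to 0, the number of zeros is divisible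
  by 3. Counting zeros of \<open>q\<close> row by row shows that there are at most 8 of them in total.
\<close>

subsection \<open>Zeros of quadratic polynomials over GF(3)\<close>

lemma field_3:
  assumes "CARD('f::field) = 3"
  shows "UNIV = {0, 1, -1 :: 'f}" and "(1::'f) \<noteq> -1" and "(2::'f) = -1" and "(3::'f) = 0"
proof -
  have fin: "finite (UNIV :: 'f set)"
    using assms by (metis card.infinite zero_neq_numeral)
  show neq: "(1::'f) \<noteq> -1"
    using two_neq_zero_if_card_3[OF assms] by (metis add.right_inverse one_add_one)
  then have "card {0, 1, -1 :: 'f} = 3" by simp
  then show U: "UNIV = {0, 1, -1 :: 'f}"
    using card_subset_eq[OF fin, of "{0, 1, -1}"] assms by simp
  have "(2::'f) \<in> {0, 1, -1}" using U by auto
  moreover have "(2::'f) \<noteq> 1" by (metis add_cancel_right_left one_add_one zero_neq_one)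
  ultimately show two: "(2::'f) = -1" using two_neq_zero_if_card_3[OF assms] by auto
  show "(3::'f) = 0" using two one_plus_numeral[of num.One, where 'a='f]
    by (metis add.right_inverse one_plus_numeral semiring_norm(3))
qed

lemma field_3_cases:
  assumes "CARD('f::field) = 3"
  shows "x = (0::'f) \<or> x = 1 \<or> x = -1"
  using field_3(1)[OF assms] by auto

lemma sum_field_3:
  fixes g :: "'f::field \<Rightarrow> 'a::comm_monoid_add"
  assumes "CARD('f) = 3"
  shows "sum g UNIV = g 0 + g 1 + g (-1)"
  using field_3(2)[OF assms] by (simp add: field_3(1)[OF assms] add.assoc)

text \<open>Since 3 = 0 in the field, only the residue \<open>n mod 3\<close> survives the cast, and
  the residues 1 and 2 stay non-zero. This turns a computation in the field into divisibility of a
  count.\<close>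

lemma of_nat_eq_0_field_3:
  assumes "CARD('f::field) = 3" and "of_nat n = (0::'f)"
  shows "3 dvd n"
proof -
  have "of_nat n = (of_nat (3 * (n div 3) + n mod 3) :: 'f)" by simp
  also have "\<dots> = of_nat (n mod 3)"
    using field_3(4)[OF assms(1)] by (simp only: of_nat_add of_nat_mult of_nat_numeral) simp
  finally have 0: "of_nat (n mod 3) = (0::'f)" using assms(2) by simp
  have "n mod 3 < 3" by simp
  then consider "n mod 3 = 0" | "n mod 3 = 1" | "n mod 3 = 2" by linarith
  then show ?thesis
    using 0 two_neq_zero_if_card_3[OF assms(1)] by cases auto
qed

lemma sum_UNIV_6: "(\<Sum>i\<in>UNIV. g i) = g (1::6) + g 2 + g 3 + g 4 + g 5 + g 6"
  for g :: "6 \<Rightarrow> 'a::comm_monoid_add"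
proof -
  have "(UNIV :: 6 set) = {1, 2, 3, 4, 5, 6}" using forall_6[of "\<lambda>i. i \<in> {1, 2, 3, 4, 5, 6}"] by auto
  then have "sum g UNIV = sum g {1, 2, 3, 4, 5, 6}" by (rule arg_cong)
  also have "\<dots> = g 1 + g 2 + g 3 + g 4 + g 5 + g 6" by (simp add: add.assoc)
  finally show ?thesis .
qed

text \<open>The value is a natural number, so that sums are counts that can be bounded, while its
  image in GF(3) is a polynomial in \<open>x\<close>.\<close>

definition zero_count :: "'f::field \<Rightarrow> nat" where
  "zero_count x = of_bool (x = 0)"

lemma of_nat_zero_count:
  fixes x :: "'f::field"
  assumes "CARD('f) = 3"
  shows "of_nat (zero_count x) = 1 - x\<^sup>2"
  using field_3_cases[OF assms, of x] by (auto simp: zero_count_def)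

text \<open>The degree bound on the number of roots. With the three field elements listed, it
  remains to exclude too many simultaneous zeros, by combining the values at 1 and -1 and dividing
  by 2.\<close>

lemma zero_count_quadratic:
  fixes A B C :: "'f::field"
  assumes F: "CARD('f) = 3"
  shows "A \<noteq> 0 \<Longrightarrow> (\<Sum>x\<in>UNIV. zero_count (A * x\<^sup>2 + B * x + C)) \<le> 2"
    and "B \<noteq> 0 \<Longrightarrow> (\<Sum>x\<in>UNIV. zero_count (B * x + C)) \<le> 1"
proof -
  have two: "(2::'f) \<noteq> 0" by (rule two_neq_zero_if_card_3[OF F])
  have "A = 0" if "C = 0" "A + B + C = 0" "A - B + C = 0"
  proof -
    have "2 * A = (A + B + C) + (A - B + C) - 2 * C" by (simp add: algebra_simps)
    then show ?thesis using that two by simp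
  qed
  then show "A \<noteq> 0 \<Longrightarrow> (\<Sum>x\<in>UNIV. zero_count (A * x\<^sup>2 + B * x + C)) \<le> 2"
    unfolding sum_field_3[OF F] by (auto simp: zero_count_def)
  \<comment> \<open>The other two pairs of zeros contain \<open>x = 0\<close>, where
    \<open>C = 0\<close> gives \<open>B = 0\<close> at once.\<close>
  have "B = 0" if "B + C = 0" "C - B = 0"
  proof -
    have "2 * B = (B + C) - (C - B)" by (simp add: algebra_simps)
    then show ?thesis using that two by simp
  qed
  then show "B \<noteq> 0 \<Longrightarrow> (\<Sum>x\<in>UNIV. zero_count (B * x + C)) \<le> 1"
    unfolding sum_field_3[OF F] by (auto simp: zero_count_def)
qed

text \<open>The total is divisible by 3 and at most 8. The bound, split into affine and diagonal
  zeros, is 6 + 2 if \<open>c1\<close> or \<open>c4\<close> is non-zero, 5 + 3 if both vanish but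
  \<open>c2\<close> does not, and 3 + 3 if all three vanish.\<close>

lemma zero_count_weights:
  fixes c1 c2 c3 c4 c5 c6 :: "'f::field"
  assumes F: "CARD('f) = 3"
    and nz: "\<not> (c1 = 0 \<and> c2 = 0 \<and> c3 = 0 \<and> c4 = 0 \<and> c5 = 0 \<and> c6 = 0)"
  defines "q \<equiv> \<lambda>a b. c1 * a\<^sup>2 + c2 * (a * b) + c3 * a + c4 * b\<^sup>2 + c5 * b + c6"
  shows "(\<Sum>a\<in>UNIV. \<Sum>b\<in>UNIV. zero_count (q a b))
    + (zero_count (c1 + c4) + zero_count (c1 + c2 - c4) + zero_count (c1 - c2 - c4)) \<in> {0, 3, 6}"
    (is "?N + ?D \<in> _")
proof -
  have two: "(2::'f) \<noteq> 0" by (rule two_neq_zero_if_card_3[OF F])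
  have "of_nat (?N + ?D) = (12 :: 'f) - ((\<Sum>a\<in>UNIV. \<Sum>b\<in>UNIV. (q a b)\<^sup>2)
      + ((c1 + c4)\<^sup>2 + (c1 + c2 - c4)\<^sup>2 + (c1 - c2 - c4)\<^sup>2))"
    by (simp add: sum_field_3[OF F] of_nat_zero_count[OF F])
  \<comment> \<open>With \<open>a\<close> and \<open>b\<close> running through 0, 1, -1 this is an
    identity with integer coefficients. The affine points alone give \<open>4 * c2\<^sup>2\<close>
    and \<open>8 * c1 * c4\<close>; the diagonal values add \<open>2 * c2\<^sup>2\<close> and
    \<open>- 2 * c1 * c4\<close>, which makes these coefficients divisible by 3.\<close>
  also have "\<dots> = 3 * (4 - (3 * c1\<^sup>2 + 3 * c4\<^sup>2 + 2 * c1 * c4 + 2 * c2\<^sup>2 + 2 * c3\<^sup>2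
      + 2 * c5\<^sup>2 + 3 * c6\<^sup>2 + 4 * c1 * c6 + 4 * c4 * c6))"
    by (simp add: sum_field_3[OF F] q_def) algebra
  finally have "3 dvd ?N + ?D"
    using of_nat_eq_0_field_3[OF F, of "?N + ?D"] field_3(4)[OF F] by simp
  moreover have "?N + ?D \<le> 8"
  proof -
    \<comment> \<open>Either variable may be the inner one; the choice depends on which leading
      coefficient is non-zero.\<close>
    have rows: "?N = (\<Sum>a\<in>UNIV. \<Sum>b\<in>UNIV. zero_count (c4 * b\<^sup>2 + (c2 * a + c5) * b + (c1 * a\<^sup>2 + c3 * a + c6)))"
      by (simp add: q_def algebra_simps)
    have cols: "?N = (\<Sum>b\<in>UNIV. \<Sum>a\<in>UNIV. zero_count (c1 * a\<^sup>2 + (c2 * b + c3) * a + (c4 * b\<^sup>2 + c5 * b + c6)))"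
      by (subst sum.swap) (simp add: q_def algebra_simps)
    consider (sq) "c1 \<noteq> 0 \<or> c4 \<noteq> 0" | (mixed) "c1 = 0" "c4 = 0" "c2 \<noteq> 0" | (affine) "c1 = 0" "c4 = 0" "c2 = 0"
      by blast
    then show ?thesis
    proof cases
      case sq
      have "?N \<le> 6"
      proof (cases "c1 = 0")
        case True
        then have "?N \<le> (\<Sum>a\<in>(UNIV::'f set). 2)"
          unfolding rows by (intro sum_mono zero_count_quadratic(1)[OF F]) (use sq in auto)
        then show ?thesis by (simp add: F)
      next
        case False
        then have "?N \<le> (\<Sum>a\<in>(UNIV::'f set). 2)"
          unfolding cols by (intro sum_mono zero_count_quadratic(1)[OF F])
        then show ?thesis by (simp add: F)
      qed
      moreover have "?D \<le> 2"
      proof -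
        have "c1 = 0 \<and> c4 = 0" if "c1 + c4 = 0" "c1 + c2 - c4 = 0" "c1 - c2 - c4 = 0"
        proof -
          have "2 * c2 = (c1 + c2 - c4) - (c1 - c2 - c4)" by simp
          then have "c2 = 0" using that two by simp
          moreover have "2 * c1 = (c1 + c4) + (c1 + c2 - c4) - c2" by simp
          ultimately have "c1 = 0" using that two by simp
          then show ?thesis using that by simp
        qed
        then show ?thesis using sq by (auto simp: zero_count_def)
      qed
      ultimately show ?thesis by simp
    next
      case mixed
      let ?R = "\<lambda>b. \<Sum>a\<in>UNIV. zero_count ((c2 * b + c3) * a + (c5 * b + c6))"
      have N: "?N = (\<Sum>b\<in>UNIV. ?R b)" unfolding cols by (simp add: mixed)
      \<comment> \<open>The coefficient of \<open>a\<close> vanishes for a single \<open>b\<close>.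
        There all three \<open>a\<close> may be zeros, elsewhere at most one, which gives 3 + 1 +
        1.\<close>
      have "?R b \<le> 1" if "b \<in> UNIV - {- c3 / c2}" for b
        using that mixed by (intro zero_count_quadratic(2)[OF F]) (auto simp: field_simps add_eq_0_iff)
      then have "(\<Sum>b\<in>UNIV - {- c3 / c2}. ?R b) \<le> (\<Sum>b\<in>UNIV - {- c3 / c2}. 1)"
        by (rule sum_mono)
      moreover have "?R (- c3 / c2) \<le> 3"
        unfolding sum_field_3[OF F] by (simp add: zero_count_def)
      ultimately have "?N \<le> 5"
        unfolding N using F by (subst sum.remove[of _ "- c3 / c2"]) (auto simp: card_Diff_singleton card_ge_0_finite)
      moreover have "?D \<le> 3" by (simp add: zero_count_def)
      ultimately show ?thesis by simp
    next
      case affine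
      have "?N \<le> 3"
      proof (cases "c3 = 0")
        case False
        then have "?N \<le> (\<Sum>b\<in>(UNIV::'f set). 1)"
          unfolding cols using affine by (simp only: mult_zero_left add_0) (intro sum_mono zero_count_quadratic(2)[OF F])
        then show ?thesis by (simp add: F)
      next
        case c3: True
        show ?thesis
        proof (cases "c5 = 0")
          case False
          then have "?N \<le> (\<Sum>b\<in>(UNIV::'f set). 1)"
            unfolding rows using affine by (simp only: mult_zero_left add_0) (intro sum_mono zero_count_quadratic(2)[OF F])
          then show ?thesis by (simp add: F)
        next
          case True
          \<comment> \<open>Only the constant \<open>c6\<close> is left; it is non-zero by
            \<open>nz\<close>, so there are no affine zeros.\<close>
          then show ?thesis using c3 affine nz by (simp add: q_def zero_count_def)
        qed
      qed
      moreover have "?D \<le> 3" by (simp add: zero_count_def)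
      ultimately show ?thesis by simp
    qed
  qed
  ultimately show ?thesis by (auto elim!: dvdE)
qed

subsection \<open>Points, joins, and hyperplanes\<close>

text \<open>A one-dimensional subspace has a one-element basis, so points can be handled through
  non-zero spanning vectors.\<close>

lemma pg_of_eq:
  fixes U :: "('f::field ^ 'n) set"
  assumes "vec.subspace U"
  shows "pg_of U = (\<lambda>x. vec.span {x}) ` (U - {0})"
proof (intro equalityI subsetI)
  fix P assume P: "P \<in> pg_of U"
  then have "vec.subspace P" "vec.dim P = 1" "P \<subseteq> U" by (auto simp: pg_of_def pg_points_def)
  obtain B where B: "B \<subseteq> P" "vec.independent B" "P \<subseteq> vec.span B" "card B = vec.dim P"
    using vec.basis_exists by metis
  then obtain x where x: "B = {x}" using \<open>vec.dim P = 1\<close> by (metis card_1_singletonE)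
  have "P = vec.span {x}"
    using B x \<open>vec.subspace P\<close> vec.span_minimal by blast
  moreover have "x \<in> U - {0}" using B x \<open>P \<subseteq> U\<close> by auto
  ultimately show "P \<in> (\<lambda>x. vec.span {x}) ` (U - {0})" by blast
next
  fix P assume "P \<in> (\<lambda>x. vec.span {x}) ` (U - {0})"
  then obtain x where "x \<in> U" "x \<noteq> 0" "P = vec.span {x}" by auto
  then show "P \<in> pg_of U"
    using assms by (auto simp: pg_of_def pg_points_def vec.span_minimal)
qed

lemma pg_points_eq: "pg_points = (\<lambda>x. vec.span {x}) ` (- {0 :: 'f::field ^ 'n})"
  using pg_of_eq[OF vec.subspace_UNIV] by (simp add: pg_of_def Compl_eq_Diff_UNIV)

lemma span_singleton_eqD:
  fixes x y :: "'f::field ^ 'n"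
  assumes "vec.span {x} = vec.span {y}"
  obtains k where "x = k *s y"
proof -
  have "x \<in> vec.span {y}" using assms vec.span_base[of x "{x}"] by simp
  then show ?thesis using that by (auto simp: vec.span_singleton)
qed

lemma span_singleton_scale:
  fixes x :: "'f::field ^ 'n"
  assumes "k \<noteq> 0"
  shows "vec.span {k *s x} = vec.span {x}"
  using vec.span_image_scale[of "{x}" "\<lambda>_. k"] assms by simp

lemma in_span_pair:
  fixes x y z :: "'f::field ^ 'n"
  shows "z \<in> vec.span {x, y} \<longleftrightarrow> (\<exists>a b. z = a *s x + b *s y)"
  by (simp add: vec.span_insert[of x "{y}"] vec.span_singleton image_iff diff_eq_eq add.commute)

lemma pg_join_span:
  fixes x y :: "'f::field ^ 'n"
  shows "pg_join (vec.span {x}) (vec.span {y}) =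
    {vec.span {z} |z. z \<noteq> 0 \<and> (\<exists>a b. z = a *s x + b *s y)}"
proof -
  have "vec.span (vec.span {x} \<union> vec.span {y}) = vec.span {x, y}"
    using vec.span_Un[of "vec.span {x}" "vec.span {y}"] vec.span_Un[of "{x}" "{y}"]
    by (simp add: vec.span_span insert_commute[of x y])
  then have "pg_join (vec.span {x}) (vec.span {y}) = (\<lambda>z. vec.span {z}) ` (vec.span {x, y} - {0})"
    by (simp add: pg_join_def pg_of_eq[OF vec.subspace_span])
  also have "\<dots> = {vec.span {z} |z. z \<noteq> 0 \<and> z \<in> vec.span {x, y}}" by blast
  finally show ?thesis by (simp only: in_span_pair)
qed

text \<open>
  The representatives are normalised so that, up to scalars, \<open>\<Sum>G = 0\<close> is their only linear relation.
  Hence \<open>a x + b y = c z + d t\<close> forces \<open>a = b\<close>, and the diagonal point is spanned by \<open>x + y\<close>.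
\<close>

lemma diagonal_triangle_eq:
  fixes G :: "('f::field ^ 'n) set"
  assumes card: "card G = 4" and sum0: "\<Sum>G = 0"
    and rel: "\<And>k x y. (\<Sum>x\<in>G. k x *s x) = 0 \<Longrightarrow> x \<in> G \<Longrightarrow> y \<in> G \<Longrightarrow> k x = k y"
  shows "diagonal_triangle ((\<lambda>x. vec.span {x}) ` G) =
    {vec.span {x + y} |x y. x \<in> G \<and> y \<in> G \<and> x \<noteq> y}" (is "?L = ?R")
proof -
  let ?s = "\<lambda>x::'f^'n. vec.span {x}"
  have rel4: "a = b \<and> c = d \<and> a = - c"
    if G: "G = {x, y, z, t}" and eq: "a *s x + b *s y = c *s z + d *s t" for x y z t a b c d
  proof -
    have "distinct [x, y, z, t]"
      using card G card_distinct[of "[x, y, z, t]"] by simp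
    then have d: "x \<noteq> y" "x \<noteq> z" "x \<noteq> t" "y \<noteq> z" "y \<noteq> t" "z \<noteq> t" by auto
    \<comment> \<open>Moving \<open>c *s z + d *s t\<close> to the left gives a relation on
      \<open>G\<close> with these coefficients, which \<open>rel\<close> forces to be equal.\<close>
    let ?k = "\<lambda>u. if u = x then a else if u = y then b else if u = z then - c else - d"
    have "(\<Sum>u\<in>G. ?k u *s u) = 0"
      using d eq by (simp add: G algebra_simps)
    from rel[OF this, of x y] rel[OF this, of z t] rel[OF this, of x z]
    show ?thesis using d by (auto simp: G)
  qed
  have comp: "\<exists>z t. G = {x, y, z, t}" if "x \<in> G" "y \<in> G" "x \<noteq> y" for x y
  proof -
    have "card (G - {x, y}) = 2" using card that by (simp add: card_Diff_subset)
    then obtain z t where "G - {x, y} = {z, t}" by (meson card_2_iff)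
    then have "G = {x, y, z, t}" using that by blast
    then show ?thesis by blast
  qed
  have four: "distinct [x, y, z, t]" if "G = {x, y, z, t}" for x y z t
    using card that card_distinct[of "[x, y, z, t]"] by simp
  have inj: "inj_on ?s G"
  proof (rule inj_onI, rule ccontr)
    fix x y assume xy: "x \<in> G" "y \<in> G" "?s x = ?s y" "x \<noteq> y"
    obtain k where k: "x = k *s y" using span_singleton_eqD[OF xy(3)] .
    obtain z t where G: "G = {x, y, z, t}" using comp[OF xy(1,2,4)] by blast
    \<comment> \<open>A proportionality would be a relation with coefficient 1 at \<open>x\<close>
      and 0 at \<open>z\<close>.\<close>
    have eq: "1 *s x + (- k) *s y = 0 *s z + 0 *s t" using k by simp
    from rel4[OF G eq] show False by simp
  qed
  have nz: "x + y \<noteq> 0" if G: "G = {x, y, z, t}" for x y z t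
  proof
    assume "x + y = 0"
    then have eq: "1 *s x + 1 *s y = 0 *s z + 0 *s t" by simp
    from rel4[OF G eq] show False by simp
  qed
  show ?thesis
  proof (intro equalityI subsetI)
    fix P assume "P \<in> ?L"
    then obtain A B C D where Q: "?s ` G = {A, B, C, D}" "distinct [A, B, C, D]"
      and P: "P \<in> pg_join A B" "P \<in> pg_join C D" by (auto simp: diagonal_triangle_def)
    have "{A, B, C, D} \<subseteq> ?s ` G" using Q by simp
    then obtain x y z t where m: "x \<in> G" "y \<in> G" "z \<in> G" "t \<in> G"
      and e: "A = ?s x" "B = ?s y" "C = ?s z" "D = ?s t" by auto
    have xy: "x \<noteq> y" using Q(2) e by auto
    have "distinct [x, y, z, t]" using Q(2) e by auto
    then have "card {x, y, z, t} = card G" using card by simp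
    moreover have "finite G" using card by (metis card.infinite zero_neq_numeral)
    ultimately have G: "G = {x, y, z, t}" using m card_subset_eq[of G "{x, y, z, t}"] by auto
    obtain u a b where u: "P = ?s u" "u \<noteq> 0" "u = a *s x + b *s y"
      using P(1) e by (auto simp: pg_join_span)
    obtain v c d where v: "P = ?s v" "v = c *s z + d *s t"
      using P(2) e by (auto simp: pg_join_span)
    obtain k where k: "u = k *s v" using span_singleton_eqD u(1) v(1) by metis
    have "a *s x + b *s y = (k * c) *s z + (k * d) *s t"
      using u(3) v(2) k by (simp add: vec.scale_right_distrib)
    from rel4[OF G this] have "u = a *s (x + y)" using u(3) by (simp add: vec.scale_right_distrib)
    moreover from this have "a \<noteq> 0" using u(2) by auto
    ultimately have "P = ?s (x + y)" using u(1) span_singleton_scale by metis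
    then show "P \<in> ?R" using m xy by blast
  next
    fix P assume "P \<in> ?R"
    then obtain x y where xy: "x \<in> G" "y \<in> G" "x \<noteq> y" "P = ?s (x + y)" by blast
    obtain z t where G: "G = {x, y, z, t}" using comp[OF xy(1-3)] by blast
    have d: "distinct [x, y, z, t]" by (rule four[OF G])
    have "x + y + z + t = 0" using sum0 d by (simp add: G add.assoc)
    \<comment> \<open>By \<open>sum0\<close> the sum of one pair is the negative of the sum of the
      complementary pair, so it lies on both joins.\<close>
    then have zt: "x + y = - 1 *s z + - 1 *s t" by (simp add: algebra_simps eq_neg_iff_add_eq_0)
    have "?s ` G = {?s x, ?s y, ?s z, ?s t}" using G by simp
    moreover have "distinct [?s x, ?s y, ?s z, ?s t]"
      using d inj_onD[OF inj] by (auto simp: G)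
    moreover have "P \<in> pg_join (?s x) (?s y)"
      using nz[OF G] xy(4) by (simp add: pg_join_span) (metis vec.scale_one)
    moreover have "P \<in> pg_join (?s z) (?s t)"
      unfolding pg_join_span using nz[OF G] xy(4) zt by blast
    ultimately show "P \<in> ?L" unfolding diagonal_triangle_def by blast
  qed
qed

text \<open>A basis \<open>B\<close> of \<open>U\<close> is extended by a vector \<open>w\<close>
  outside \<open>U\<close>. The functional is a row of the matrix of a linear map \<open>g\<close>
  that kills \<open>B\<close> but not \<open>w\<close>.\<close>

lemma hyperplane_equation:
  fixes U :: "('f::field ^ 'n) set"
  assumes "vec.subspace U" and "vec.dim U + 1 = CARD('n)"
  obtains c where "c \<noteq> 0" and "U = {x. (\<Sum>i\<in>UNIV. c $ i * x $ i) = 0}"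
proof -
  obtain B where B: "B \<subseteq> U" "vec.independent B" "U \<subseteq> vec.span B" "card B = vec.dim U"
    using vec.basis_exists by metis
  have spanB: "vec.span B = U" using B assms(1) vec.span_minimal by blast
  have "U \<noteq> UNIV" using assms(2) by (auto simp: vec.dim_UNIV card_cart_basis)
  then obtain w where w: "w \<notin> U" by auto
  have ind: "vec.independent (insert w B)" using B w spanB by (simp add: vec.independent_insert)
  then have "vec.dim (insert w B) = CARD('n)"
    using w assms(2) spanB vec.dim_span[of B] by (simp add: vec.dim_insert)
  then have full: "vec.span (insert w B) = UNIV"
    using vec.dim_eq_full by (metis card_cart_basis vec.dimension_def)
  obtain g :: "'f ^ 'n \<Rightarrow> 'f ^ 'n" where g: "Vector_Spaces.linear (*s) (*s) g"
    and gB: "\<forall>x\<in>insert w B. g x = (if x = w then 1 else 0)"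
    using vec.linear_independent_extend[OF ind, of "\<lambda>x. if x = w then 1 else 0"] by metis
  interpret g: Vector_Spaces.linear "(*s)" "(*s)" g by (rule g)
  \<comment> \<open>Any row serves, because \<open>g w\<close> is 1 in every coordinate.\<close>
  obtain i0 :: 'n where True by simp
  define c where "c = matrix g $ i0"
  have h: "(\<Sum>i\<in>UNIV. c $ i * x $ i) = g x $ i0" for x
    using arg_cong[OF matrix_works[OF g, of x], of "\<lambda>v. v $ i0"]
    by (simp add: matrix_vector_mult_def c_def)
  have gU: "g x = 0" if "x \<in> U" for x
    using g.eq_0_on_span[of B x] gB w B(1) that spanB by (metis insertI2 subsetD)
  have "x \<in> U" if "g x $ i0 = 0" for x
  proof -
    have "x \<in> vec.span (insert w B)" using full by simp
    then obtain k where k: "x - k *s w \<in> U" unfolding vec.span_insert spanB by blast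
    then have "g x = k *s g w" using gU[OF k] by (simp add: g.diff g.scale)
    then have "k = 0" using that gB by simp
    then show ?thesis using k by simp
  qed
  then have "U = {x. (\<Sum>i\<in>UNIV. c $ i * x $ i) = 0}" using gU by (auto simp: h)
  moreover from this w have "c \<noteq> 0" by auto
  ultimately show ?thesis using that by blast
qed

section \<open>Coordinate changes and the symmetric square\<close>

lemma sym_prod_linear: "Vector_Spaces.linear (*s) (*s) (sym_prod a)"
  for a :: "'f::field ^ 3"
  unfolding Vector_Spaces.linear_iff using vec.vector_space_axioms vec.vector_space_axioms
  by (simp add: sym_prod_def vec_eq_iff forall_6 vector_6 algebra_simps add_divide_distrib)

lemma sym_prod_commute: "sym_prod a b = sym_prod b a"
  by (simp add: sym_prod_def mult.commute add.commute)

text \<open>The universal property, applied to \<open>sym_prod (h a) (h b)\<close>, lifts both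
  \<open>f\<close> and its inverse. Its uniqueness part shows that the two lifts are inverse to each
  other.\<close>

lemma sym_prod_functorial:
  fixes f :: "'f::field ^ 3 \<Rightarrow> 'f ^ 3"
  assumes two: "(2::'f) \<noteq> 0" and f: "Vector_Spaces.linear (*s) (*s) f" and "bij f"
  obtains \<Phi> where "Vector_Spaces.linear (*s) (*s) \<Phi>" and "bij \<Phi>"
    and "\<And>a b. \<Phi> (sym_prod a b) = sym_prod (f a) (f b)"
proof -
  define g where "g = inv f"
  have g: "Vector_Spaces.linear (*s) (*s) g"
    unfolding g_def using vec.inj_linear_imp_inv_linear[OF f] \<open>bij f\<close> by (simp add: bij_def)
  have gf: "g (f x) = x" and fg: "f (g x) = x" for x
    using \<open>bij f\<close> by (simp_all add: g_def bij_is_inj bij_is_surj surj_f_inv_f)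
  have lift: "\<exists>\<Phi>. Vector_Spaces.linear (*s) (*s) \<Phi> \<and> (\<forall>a b. \<Phi> (sym_prod a b) = sym_prod (h a) (h b))"
    if h: "Vector_Spaces.linear (*s) (*s) h" for h :: "'f ^ 3 \<Rightarrow> 'f ^ 3"
    by (rule ex1_implies_ex[OF sym_prod_universal[OF two]])
      (use Vector_Spaces.linear_compose[OF h sym_prod_linear] sym_prod_commute in \<open>auto simp: o_def\<close>)
  \<comment> \<open>Uniqueness for the bilinear map \<open>sym_prod\<close> itself, whose
    factorisation is the identity.\<close>
  have unique: "\<Psi> = id" if "Vector_Spaces.linear (*s) (*s) \<Psi>" "\<And>a b. \<Psi> (sym_prod a b) = sym_prod a b"
    for \<Psi> :: "'f ^ 6 \<Rightarrow> 'f ^ 6"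
    using sym_prod_universal[OF two, of "(*s)" sym_prod, OF sym_prod_linear sym_prod_commute]
      vec.linear_id that by (auto simp: id_def)
  obtain \<Phi> \<Psi> where \<Phi>: "Vector_Spaces.linear (*s) (*s) \<Phi>" "\<And>a b. \<Phi> (sym_prod a b) = sym_prod (f a) (f b)"
    and \<Psi>: "Vector_Spaces.linear (*s) (*s) \<Psi>" "\<And>a b. \<Psi> (sym_prod a b) = sym_prod (g a) (g b)"
    using lift[OF f] lift[OF g] by blast
  have "\<Psi> \<circ> \<Phi> = id" "\<Phi> \<circ> \<Psi> = id"
    using gf fg by (auto intro!: unique Vector_Spaces.linear_compose[OF \<Phi>(1) \<Psi>(1)]
        Vector_Spaces.linear_compose[OF \<Psi>(1) \<Phi>(1)] simp: \<Phi>(2) \<Psi>(2))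
  then have "bij \<Phi>" by (rule o_bij)
  with \<Phi> show ?thesis using that by blast
qed

text \<open>A basis \<open>u\<close>, \<open>v\<close> of \<open>U\<close> and a vector
  \<open>w\<close> outside it become the coordinate axes, so that \<open>U\<close> gets the equation
  \<open>x $ 3 = 0\<close>.\<close>

lemma plane_coordinates:
  fixes U :: "('f::field ^ 3) set"
  assumes "vec.subspace U" and "vec.dim U = 2"
  obtains f :: "'f ^ 3 \<Rightarrow> 'f ^ 3" where "Vector_Spaces.linear (*s) (*s) f" and "bij f" and "f ` {x. x $ 3 = 0} = U"
proof -
  obtain B where B: "B \<subseteq> U" "vec.independent B" "U \<subseteq> vec.span B" "card B = vec.dim U"
    using vec.basis_exists by metis
  have spanB: "vec.span B = U" using B assms(1) vec.span_minimal by blast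
  have "U \<noteq> UNIV" using assms(2) by (auto simp: vec.dim_UNIV card_cart_basis)
  then obtain w where w: "w \<notin> U" by auto
  have "vec.dim (insert w B) = 3"
    using w assms(2) spanB vec.dim_span[of B] by (simp add: vec.dim_insert)
  then have full: "vec.span (insert w B) = UNIV"
    using vec.dim_eq_full[of "insert w B"] card_cart_basis by (simp add: vec.dimension_def card_cart_basis)
  obtain u v where uv: "B = {u, v}" using B assms(2) by (metis card_2_iff)
  define f where "f x = x $ 1 *s u + x $ 2 *s v + x $ 3 *s w" for x :: "'f ^ 3"
  have lin: "Vector_Spaces.linear (*s) (*s) f"
    unfolding Vector_Spaces.linear_iff using vec.vector_space_axioms
    by (simp add: f_def vec.scale_left_distrib vec.scale_right_distrib algebra_simps)
  have Uf: "y \<in> U \<longleftrightarrow> (\<exists>a b. y = a *s u + b *s v)" for y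
    using in_span_pair[of y u v] spanB uv by simp
  have img: "f ` {x. x $ 3 = 0} = U"
  proof (intro equalityI subsetI)
    fix y assume "y \<in> U"
    then obtain a b where "y = a *s u + b *s v" using Uf by blast
    then have "y = f (vector [a, b, 0])" by (simp add: f_def)
    then show "y \<in> f ` {x. x $ 3 = 0}" by (auto intro!: image_eqI[of _ _ "vector [a, b, 0]"])
  qed (auto simp: f_def Uf)
  have "surj f"
  proof -
    have "\<exists>x. y = f x" for y
    proof -
      have "y \<in> vec.span (insert w B)" using full by simp
      then obtain k where "y - k *s w \<in> U" unfolding vec.span_insert spanB by blast
      then obtain a b where "y - k *s w = a *s u + b *s v" using Uf by blast
      then have "y = f (vector [a, b, k])" by (simp add: f_def algebra_simps)
      then show ?thesis by blast
    qed
    then show ?thesis by (auto simp: surj_def)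
  qed
  then have "bij f" using vec.linear_surj_imp_inj[OF lin] by (simp add: bij_def)
  then show ?thesis using that lin img by blast
qed

subsection \<open>The point set in coordinates\<close>

text \<open>The squares of (1,0,0), (0,1,0), (1,1,0), (1,-1,0), which span the points of the conic.
  With these scalars their sum is 0 over GF(3).\<close>

definition quad_vecs :: "('f::field ^ 6) set" where
  "quad_vecs = {vector [1, 0, 0, 0, 0, 0], vector [0, 0, 0, 1, 0, 0],
    vector [1, 1, 0, 1, 0, 0], vector [1, -1, 0, 1, 0, 0]}"

text \<open>Up to sign, the sums of two vectors of \<open>quad_vecs\<close>; complementary pairs
  give the same vector up to sign.\<close>

definition diag_vecs :: "('f::field ^ 6) set" where
  "diag_vecs = {vector [1, 0, 0, 1, 0, 0], vector [1, 1, 0, -1, 0, 0], vector [1, -1, 0, -1, 0, 0]}"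

definition affine_vec :: "'f::field \<times> 'f \<Rightarrow> 'f ^ 6" where
  "affine_vec = (\<lambda>(a, b). vector [a\<^sup>2, a * b, a, b\<^sup>2, b, 1])"

lemma eq_vec6_iff: "x = y \<longleftrightarrow> x$1 = y$1 \<and> x$2 = y$2 \<and> x$3 = y$3 \<and> x$4 = y$4 \<and> x$5 = y$5 \<and> x$6 = y$6"
  for x y :: "'a ^ 6"
  by (simp add: vec_eq_iff forall_6)

context
  assumes F: "CARD('f::field) = 3"
begin

text \<open>Equality holds for vectors, not just for points: the non-zero scalars are 1 and -1, and
  \<open>x\<close> and \<open>-x\<close> have the same square.\<close>

lemma quad_vecs_eq: "(\<lambda>x. sym_prod x x) ` ({x. x $ 3 = 0} - {0}) = (quad_vecs :: ('f ^ 6) set)"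
proof (intro equalityI subsetI)
  fix t :: "'f ^ 6" assume "t \<in> (\<lambda>x. sym_prod x x) ` ({x. x $ 3 = 0} - {0})"
  then obtain x :: "'f ^ 3" where x: "t = sym_prod x x" "x $ 3 = 0" "x \<noteq> 0" by auto
  then have "x $ 1 \<noteq> 0 \<or> x $ 2 \<noteq> 0" by (auto simp: vec_eq_iff forall_3)
  then show "t \<in> quad_vecs"
    using x field_3_cases[OF F, of "x $ 1"] field_3_cases[OF F, of "x $ 2"]
    by (auto simp: sym_prod_self[OF two_neq_zero_if_card_3[OF F]] quad_vecs_def)
next
  fix t :: "'f ^ 6" assume t: "t \<in> quad_vecs"
  define I where "I = (\<lambda>x :: 'f ^ 3. sym_prod x x) ` ({x. x $ 3 = 0} - {0})"
  have I: "vector [a\<^sup>2, a * b, 0, b\<^sup>2, 0, 0] \<in> I" if "a \<noteq> 0 \<or> b \<noteq> 0" for a b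
  proof -
    let ?x = "vector [a, b, 0] :: 'f ^ 3"
    have "?x \<in> {x. x $ 3 = 0} - {0}"
      using that by (auto simp: vec_eq_iff forall_3)
    then have "sym_prod ?x ?x \<in> I" unfolding I_def by (rule imageI)
    then show ?thesis by (simp add: sym_prod_self[OF two_neq_zero_if_card_3[OF F]])
  qed
  have "t \<in> I"
    using t I[of 1 0] I[of 0 1] I[of 1 1] I[of 1 "-1"] by (auto simp: quad_vecs_def)
  then show "t \<in> (\<lambda>x. sym_prod x x) ` ({x. x $ 3 = 0} - {0})" by (simp add: I_def)
qed

lemma affine_vec_eq: "(\<lambda>x. sym_prod x x) ` {x. x $ 3 \<noteq> 0} = range (affine_vec :: 'f \<times> 'f \<Rightarrow> 'f ^ 6)"
proof (intro equalityI subsetI)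
  fix t :: "'f ^ 6" assume "t \<in> (\<lambda>x. sym_prod x x) ` {x. x $ 3 \<noteq> 0}"
  then obtain x :: "'f ^ 3" where x: "t = sym_prod x x" "x $ 3 \<noteq> 0" by auto
  then have "x $ 3 = 1 \<or> x $ 3 = -1" using field_3_cases[OF F, of "x $ 3"] by auto
  \<comment> \<open>The entry \<open>x $ 3\<close> is 1 or -1, hence its own inverse, so multiplying
    by it makes the third coordinate 1 without changing the square.\<close>
  then have "t = affine_vec (x $ 1 * x $ 3, x $ 2 * x $ 3)"
    using x(1) by (auto simp: sym_prod_self[OF two_neq_zero_if_card_3[OF F]] affine_vec_def)
  then show "t \<in> range affine_vec" by simp
next
  fix t :: "'f ^ 6" assume "t \<in> range affine_vec"
  then obtain a b where "t = affine_vec (a, b)" by auto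
  then have "t = sym_prod (vector [a, b, 1]) (vector [a, b, 1])"
    by (simp add: sym_prod_self[OF two_neq_zero_if_card_3[OF F]] affine_vec_def)
  then show "t \<in> (\<lambda>x. sym_prod x x) ` {x. x $ 3 \<noteq> 0}" by auto
qed

lemma inj_affine_vec: "inj (affine_vec :: 'f \<times> 'f \<Rightarrow> 'f ^ 6)"
  by (auto simp: inj_on_def affine_vec_def eq_vec6_iff vector_6)

lemma card_quad_vecs: "card (quad_vecs :: ('f ^ 6) set) = 4"
  using field_3(2)[OF F] by (simp add: quad_vecs_def eq_vec6_iff vector_6)

lemma sum_quad_vecs: "sum g (quad_vecs :: ('f ^ 6) set) =
    g (vector [1, 0, 0, 0, 0, 0]) + g (vector [0, 0, 0, 1, 0, 0])
    + g (vector [1, 1, 0, 1, 0, 0]) + g (vector [1, -1, 0, 1, 0, 0])"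
  for g :: "_ \<Rightarrow> 'a::comm_monoid_add"
  using field_3(2)[OF F] by (simp add: quad_vecs_def eq_vec6_iff vector_6 add.assoc)

lemma quad_vecs_sum_0: "\<Sum>quad_vecs = (0 :: 'f ^ 6)"
  using field_3(3)[OF F] by (simp add: sum_quad_vecs[of "\<lambda>x. x"] eq_vec6_iff vector_6)

text \<open>Coordinate 2 equates the last two coefficients. Coordinates 1 and 4 then have the form
  \<open>a + b + b = 0\<close>, which means \<open>a = b\<close> in characteristic 3.\<close>

lemma quad_vecs_relation:
  fixes k :: "'f ^ 6 \<Rightarrow> 'f"
  assumes "(\<Sum>x\<in>quad_vecs. k x *s x) = 0" and "x \<in> quad_vecs" and "y \<in> quad_vecs"
  shows "k x = k y"
proof -
  let ?k = "\<lambda>v. k (vector v)"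
  have tr: "a = b" if "a + b + b = 0" for a b :: 'f
  proof -
    have "a - b = (a + b + b) - 3 * b" by (simp add: algebra_simps)
    then show ?thesis using that field_3(4)[OF F] by simp
  qed
  from arg_cong[OF assms(1), of "\<lambda>v. v $ 2"]
  have e2: "?k [1, 1, 0, 1, 0, 0] = ?k [1, -1, 0, 1, 0, 0]"
    by (simp add: sum_quad_vecs vector_6)
  from arg_cong[OF assms(1), of "\<lambda>v. v $ 1"]
  have e1: "?k [1, 0, 0, 0, 0, 0] = ?k [1, -1, 0, 1, 0, 0]"
    by - (rule tr, simp add: sum_quad_vecs vector_6 e2)
  from arg_cong[OF assms(1), of "\<lambda>v. v $ 4"]
  have e4: "?k [0, 0, 0, 1, 0, 0] = ?k [1, -1, 0, 1, 0, 0]"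
    by - (rule tr, simp add: sum_quad_vecs vector_6 e2)
  show ?thesis
    using assms(2,3) e1 e2 e4 unfolding quad_vecs_def by (elim insertE emptyE) simp_all
qed

lemma sum_diag_vecs: "sum g (diag_vecs :: ('f ^ 6) set) =
    g (vector [1, 0, 0, 1, 0, 0]) + g (vector [1, 1, 0, -1, 0, 0]) + g (vector [1, -1, 0, -1, 0, 0])"
  for g :: "_ \<Rightarrow> 'a::comm_monoid_add"
  using field_3(2)[OF F] by (simp add: diag_vecs_def eq_vec6_iff vector_6 add.assoc)

lemma quad_vecs_add:
  fixes x y :: "'f ^ 6"
  assumes "x \<in> quad_vecs" "y \<in> quad_vecs" "x \<noteq> y"
  shows "\<exists>d\<in>diag_vecs. x + y = d \<or> x + y = -1 *s d"
proof -
  \<comment> \<open>Naming the symmetric relation reduces the twelve ordered pairs to six.\<close>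
  define P where "P x y \<longleftrightarrow> (\<exists>d\<in>diag_vecs. x + y = d \<or> x + y = -1 *s d)" for x y :: "'f ^ 6"
  have sym: "P y x" if "P x y" for x y using that by (simp add: P_def add.commute)
  have PI: "P x y" if "d \<in> diag_vecs" "x + y = d \<or> x + y = -1 *s d" for x y d
    using that unfolding P_def by blast
  have p12: "P (vector [1, 0, 0, 0, 0, 0]) (vector [0, 0, 0, 1, 0, 0])"
    by (rule PI[of "vector [1, 0, 0, 1, 0, 0]"]) (simp_all add: diag_vecs_def eq_vec6_iff vector_6 field_3(3)[OF F])
  have p13: "P (vector [1, 0, 0, 0, 0, 0]) (vector [1, 1, 0, 1, 0, 0])"
    by (rule PI[of "vector [1, -1, 0, -1, 0, 0]"]) (simp_all add: diag_vecs_def eq_vec6_iff vector_6 field_3(3)[OF F])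
  have p14: "P (vector [1, 0, 0, 0, 0, 0]) (vector [1, -1, 0, 1, 0, 0])"
    by (rule PI[of "vector [1, 1, 0, -1, 0, 0]"]) (simp_all add: diag_vecs_def eq_vec6_iff vector_6 field_3(3)[OF F])
  have p23: "P (vector [0, 0, 0, 1, 0, 0]) (vector [1, 1, 0, 1, 0, 0])"
    by (rule PI[of "vector [1, 1, 0, -1, 0, 0]"]) (simp_all add: diag_vecs_def eq_vec6_iff vector_6 field_3(3)[OF F])
  have p24: "P (vector [0, 0, 0, 1, 0, 0]) (vector [1, -1, 0, 1, 0, 0])"
    by (rule PI[of "vector [1, -1, 0, -1, 0, 0]"]) (simp_all add: diag_vecs_def eq_vec6_iff vector_6 field_3(3)[OF F])
  have p34: "P (vector [1, 1, 0, 1, 0, 0]) (vector [1, -1, 0, 1, 0, 0])"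
    by (rule PI[of "vector [1, 0, 0, 1, 0, 0]"]) (simp_all add: diag_vecs_def eq_vec6_iff vector_6 field_3(3)[OF F])
  have "P x y"
    using assms p12 p13 p14 p23 p24 p34 p12[THEN sym] p13[THEN sym] p14[THEN sym] p23[THEN sym] p24[THEN sym] p34[THEN sym]
    unfolding quad_vecs_def by (elim insertE emptyE) (simp_all only: simp_thms)
  then show ?thesis by (simp add: P_def)
qed

text \<open>Each splitting of the quadrangle into two pairs has one pair containing
  \<open>?q\<close>, so sums with this fixed vector suffice.\<close>

lemma diag_vecs_split:
  fixes d :: "'f ^ 6"
  assumes "d \<in> diag_vecs"
  shows "\<exists>x\<in>quad_vecs. \<exists>y\<in>quad_vecs. x \<noteq> y \<and> (d = x + y \<or> d = -1 *s (x + y))"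
proof -
  have m: "(2::'f) = -1" "(1::'f) \<noteq> -1" by (rule field_3[OF F])+
  let ?q = "vector [1, 0, 0, 0, 0, 0] :: 'f ^ 6"
  from assms consider "d = vector [1, 0, 0, 1, 0, 0]" | "d = vector [1, 1, 0, -1, 0, 0]"
    | "d = vector [1, -1, 0, -1, 0, 0]" by (auto simp: diag_vecs_def)
  then obtain y where "y \<in> quad_vecs" "?q \<noteq> y" "d = ?q + y \<or> d = -1 *s (?q + y)"
  proof cases
    case 1
    show ?thesis
      by (rule that[of "vector [0, 0, 0, 1, 0, 0]"]) (simp_all add: 1 quad_vecs_def eq_vec6_iff vector_6)
  next
    case 2
    show ?thesis
      by (rule that[of "vector [1, -1, 0, 1, 0, 0]"]) (simp_all add: 2 m quad_vecs_def eq_vec6_iff vector_6)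
  next
    case 3
    show ?thesis
      by (rule that[of "vector [1, 1, 0, 1, 0, 0]"]) (simp_all add: 3 m quad_vecs_def eq_vec6_iff vector_6)
  qed
  moreover have "?q \<in> quad_vecs" by (simp add: quad_vecs_def)
  ultimately show ?thesis by blast
qed

lemma card_hyperplane_weights:
  fixes c :: "'f ^ 6"
  assumes "c \<noteq> 0"
  shows "card {t \<in> range affine_vec \<union> diag_vecs. (\<Sum>i\<in>UNIV. c $ i * t $ i) = 0} \<in> {0, 3, 6}"
proof -
  define h where "h t = (\<Sum>i\<in>UNIV. c $ i * t $ i)" for t
  have fin: "finite (UNIV :: 'f set)" using F by (metis card.infinite zero_neq_numeral)
  then have finp: "finite (UNIV :: ('f \<times> 'f) set)" by (simp flip: UNIV_Times_UNIV)
  \<comment> \<open>The sixth coordinate is 1 on the affine vectors and 0 on the diagonal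
    ones.\<close>
  have disj: "range affine_vec \<inter> (diag_vecs :: ('f ^ 6) set) = {}"
    by (auto simp: affine_vec_def diag_vecs_def eq_vec6_iff vector_6)
  have fd: "finite (diag_vecs :: ('f ^ 6) set)" by (simp add: diag_vecs_def)
  let ?S = "range affine_vec \<union> diag_vecs :: ('f ^ 6) set"
  have "finite ?S" using fd finp by simp
  then have "card {t \<in> ?S. h t = 0} = (\<Sum>t\<in>?S. zero_count (h t))"
    using sum.inter_filter[of ?S "\<lambda>_. 1::nat" "\<lambda>t. h t = 0"]
    by (simp only: card_eq_sum zero_count_def of_bool_def)
  also have "\<dots> = (\<Sum>p\<in>UNIV. zero_count (h (affine_vec p))) + (\<Sum>t\<in>diag_vecs. zero_count (h t))"
    using fd finp disj inj_affine_vec by (simp add: sum.union_disjoint sum.reindex)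
  also have "(\<Sum>p\<in>UNIV. zero_count (h (affine_vec p))) = (\<Sum>a\<in>UNIV. \<Sum>b\<in>UNIV. zero_count (h (affine_vec (a, b))))"
    by (simp add: sum.cartesian_product flip: UNIV_Times_UNIV)
  \<comment> \<open>On \<open>affine_vec (a, b)\<close> the functional is the polynomial of
    \<open>zero_count_weights\<close>, with the entries of \<open>c\<close> as coefficients in their
    order.\<close>
  also have "\<dots> + (\<Sum>t\<in>diag_vecs. zero_count (h t)) \<in> {0, 3, 6}"
    using zero_count_weights[OF F, of "c $ 1" "c $ 2" "c $ 3" "c $ 4" "c $ 5" "c $ 6"] assms
    by (simp add: h_def sum_UNIV_6 affine_vec_def vector_6 sum_diag_vecs eq_vec6_iff)
  finally show ?thesis by (simp add: h_def)
qed

lemma card_weights: "card (range affine_vec \<union> diag_vecs :: ('f ^ 6) set) = 12"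
proof -
  have fin: "finite (UNIV :: 'f set)" using F by (metis card.infinite zero_neq_numeral)
  then have finp: "finite (UNIV :: ('f \<times> 'f) set)" by (simp flip: UNIV_Times_UNIV)
  have "card (range (affine_vec :: 'f \<times> 'f \<Rightarrow> 'f ^ 6)) = 9"
    using F by (simp add: card_image[OF inj_affine_vec])
  moreover have "card (diag_vecs :: ('f ^ 6) set) = 3"
    using sum_diag_vecs[of "\<lambda>_. 1::nat"] by simp
  moreover have disj: "range affine_vec \<inter> (diag_vecs :: ('f ^ 6) set) = {}"
    by (auto simp: affine_vec_def diag_vecs_def eq_vec6_iff vector_6)
  moreover have fd: "finite (diag_vecs :: ('f ^ 6) set)" by (simp add: diag_vecs_def)
  ultimately show ?thesis using finp by (simp add: card_Un_disjoint)
qed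

text \<open>
  Each of these vectors has 1 as its first non-zero entry among the coordinates 6, 1, 4, in this order.
\<close>

lemma normalised_scale_eq:
  fixes x y :: "'f ^ 6"
  assumes "x \<in> quad_vecs \<union> range affine_vec \<union> diag_vecs"
    and "y \<in> quad_vecs \<union> range affine_vec \<union> diag_vecs" and "x = k *s y"
  shows "x = y"
proof -
  have n: "t $ 6 = 1 \<or> t $ 6 = 0 \<and> t $ 1 = 1 \<or> t $ 6 = 0 \<and> t $ 1 = 0 \<and> t $ 4 = 1"
    if "t \<in> quad_vecs \<union> range affine_vec \<union> diag_vecs" for t :: "'f ^ 6"
    using that by (auto simp: quad_vecs_def diag_vecs_def affine_vec_def vector_6)
  have "k = 1" using n[OF assms(1)] n[OF assms(2)] assms(3) by auto
  then show ?thesis using assms(3) by simp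
qed

end

section \<open>Transport to an arbitrary line\<close>

lemma hyperplane_vimage:
  fixes U :: "('f::field ^ 'n) set"
  assumes U: "vec.subspace U" "vec.dim U + 1 = CARD('n)"
    and \<Phi>: "Vector_Spaces.linear (*s) (*s) \<Phi>" "bij \<Phi>"
  obtains c :: "'f ^ 'n" where "c \<noteq> 0" and "\<And>x. \<Phi> x \<in> U \<longleftrightarrow> (\<Sum>i\<in>UNIV. c $ i * x $ i) = 0"
proof -
  \<comment> \<open>The explicit vectors stay fixed and the hyperplane is pulled back instead; the
    bijection preserves its dimension.\<close>
  have "vec.subspace (\<Phi> -` U)" by (rule vec.linear_subspace_vimage[OF \<Phi>(1) U(1)])
  moreover have "vec.dim (\<Phi> -` U) = vec.dim U"
  proof -
    have "vec.dim (\<Phi> ` (\<Phi> -` U)) = vec.dim (\<Phi> -` U)"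
      by (rule vec.dim_image_eq[OF \<Phi>(1)]) (use \<Phi>(2) in \<open>auto simp: bij_def inj_on_def\<close>)
    then show ?thesis using \<Phi>(2) by (simp add: bij_is_surj)
  qed
  ultimately obtain c where "c \<noteq> 0" "\<Phi> -` U = {x. (\<Sum>i\<in>UNIV. c $ i * x $ i) = 0}"
    using hyperplane_equation[of "\<Phi> -` U"] U(2) by auto
  then show ?thesis using that by blast
qed

theorem theorem1:
  fixes l_inf :: "('f::field ^ 3) set set"
    and \<Gamma>_inf \<Delta>_inf \<K> :: "('f ^ 6) set set"
  assumes "CARD('f) = 3"
    and "pg_line l_inf"
    and "\<Gamma>_inf = veronese ` l_inf"
    and "\<Delta>_inf = diagonal_triangle \<Gamma>_inf"
    and "\<K> = (veronese ` pg_points - \<Gamma>_inf) \<union> \<Delta>_inf"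
  shows "(\<forall>H. pg_hyperplane H \<longrightarrow> card (H \<inter> \<K>) \<in> {0, 3, 6}) \<and> card \<K> = 12"
proof -
  note F = assms(1)
  have two: "(2::'f) \<noteq> 0" by (rule two_neq_zero_if_card_3[OF F])
  obtain U where U: "vec.subspace U" "vec.dim U = 2" "l_inf = pg_of U"
    using assms(2) by (auto simp: pg_line_def)
  obtain f :: "'f ^ 3 \<Rightarrow> 'f ^ 3" where f: "Vector_Spaces.linear (*s) (*s) f" "bij f" "f ` {x. x $ 3 = 0} = U"
    using plane_coordinates[OF U(1,2)] .
  interpret f: Vector_Spaces.linear "(*s)" "(*s)" f by (rule f(1))
  obtain \<Phi> where \<Phi>: "Vector_Spaces.linear (*s) (*s) \<Phi>" "bij \<Phi>"
    and \<Phi>_sym: "\<And>a b. \<Phi> (sym_prod a b) = sym_prod (f a) (f b)"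
    using sym_prod_functorial[OF two f(1,2)] by blast
  interpret \<Phi>: Vector_Spaces.linear "(*s)" "(*s)" \<Phi> by (rule \<Phi>(1))
  have inj\<Phi>: "inj \<Phi>" using \<Phi>(2) by (rule bij_is_inj)
  \<comment> \<open>\<open>S\<close> sends an explicit vector to the point that it represents in the
    original configuration.\<close>
  define S where "S y = vec.span {\<Phi> y}" for y
  let ?T = "range affine_vec \<union> diag_vecs :: ('f ^ 6) set"

  have S_scale: "S (k *s y) = S y" if "k \<noteq> 0" for k y
    using that by (simp add: S_def \<Phi>.scale span_singleton_scale)
  \<comment> \<open>Injectivity on all three families lets set differences and cardinalities of
    points be computed on vectors.\<close>
  have inj_S: "inj_on S (quad_vecs \<union> range affine_vec \<union> diag_vecs)"
  proof (rule inj_onI)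
    fix x y :: "'f ^ 6"
    assume xy: "x \<in> quad_vecs \<union> range affine_vec \<union> diag_vecs"
      "y \<in> quad_vecs \<union> range affine_vec \<union> diag_vecs" and "S x = S y"
    then obtain k where "\<Phi> x = k *s \<Phi> y" unfolding S_def by (elim span_singleton_eqD)
    then have "\<Phi> x = \<Phi> (k *s y)" by (simp add: \<Phi>.scale)
    then have "x = k *s y" using inj\<Phi> by (simp add: inj_eq)
    then show "x = y" using normalised_scale_eq[OF F xy] by blast
  qed

  have f0: "f x = 0 \<longleftrightarrow> x = 0" for x
    using f(2) f.zero by (metis bij_is_inj injD)
  have ver: "veronese ` (\<lambda>x. vec.span {x}) ` f ` X = S ` (\<lambda>x. sym_prod x x) ` X" for X
    by (simp add: image_image veronese_span S_def \<Phi>_sym)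
  have "U - {0} = f ` ({x. x $ 3 = 0} - {0})" using f(3) f0 by auto
  then have \<Gamma>: "\<Gamma>_inf = S ` quad_vecs"
    by (simp add: assms(3) U(3) pg_of_eq[OF U(1)] ver quad_vecs_eq[OF F])
  have "- {0} = f ` ({x. x $ 3 = 0} - {0} \<union> {x. x $ 3 \<noteq> 0})"
  proof -
    have "{x :: 'f ^ 3. x $ 3 = 0} - {0} \<union> {x. x $ 3 \<noteq> 0} = - {0}" by auto
    then show ?thesis using f(2) f0 by (simp add: bij_image_Compl_eq f.zero)
  qed
  then have points: "veronese ` pg_points = S ` (quad_vecs \<union> range affine_vec)"
    unfolding pg_points_eq by (simp only: ver image_Un[of "\<lambda>x. sym_prod x x"] quad_vecs_eq[OF F] affine_vec_eq[OF F])
  have "veronese ` pg_points - \<Gamma>_inf = S ` (quad_vecs \<union> range affine_vec - quad_vecs)"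
    unfolding points \<Gamma> by (rule inj_on_image_set_diff[OF inj_S, symmetric]) auto
  also have "quad_vecs \<union> range affine_vec - quad_vecs = (range affine_vec :: ('f ^ 6) set)"
    by (auto simp: quad_vecs_def affine_vec_def eq_vec6_iff vector_6)
  finally have affine: "veronese ` pg_points - \<Gamma>_inf = S ` range affine_vec" .

  \<comment> \<open>The sum and the relations of \<open>quad_vecs\<close> carry over to the images,
    because \<Phi> is linear and injective.\<close>
  have "diagonal_triangle ((\<lambda>x. vec.span {x}) ` \<Phi> ` quad_vecs) =
    {vec.span {x + y} |x y. x \<in> \<Phi> ` quad_vecs \<and> y \<in> \<Phi> ` quad_vecs \<and> x \<noteq> y}"
  proof (rule diagonal_triangle_eq)
    have inj: "inj_on \<Phi> quad_vecs" using inj\<Phi> by (rule inj_on_subset) simp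
    show "card (\<Phi> ` quad_vecs) = 4" by (simp add: card_image[OF inj] card_quad_vecs[OF F])
    show "\<Sum>(\<Phi> ` quad_vecs) = 0"
      using quad_vecs_sum_0[OF F] by (simp add: sum.reindex[OF inj] flip: \<Phi>.sum)
    fix k x y assume k: "(\<Sum>x\<in>\<Phi> ` quad_vecs. k x *s x) = 0"
      and xy: "x \<in> \<Phi> ` quad_vecs" "y \<in> \<Phi> ` quad_vecs"
    have "\<Phi> (\<Sum>x\<in>quad_vecs. k (\<Phi> x) *s x) = 0"
      using k by (simp add: sum.reindex[OF inj] \<Phi>.sum \<Phi>.scale)
    then have "(\<Sum>x\<in>quad_vecs. k (\<Phi> x) *s x) = 0"
      using inj\<Phi> \<Phi>.zero by (metis injD)
    from quad_vecs_relation[OF F this] show "k x = k y" using xy by auto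
  qed
  also have "\<dots> = {S (x + y) |x y. x \<in> quad_vecs \<and> y \<in> quad_vecs \<and> x \<noteq> y}" (is "?L = ?D")
  proof -
    have "P \<in> ?L \<longleftrightarrow> (\<exists>x\<in>quad_vecs. \<exists>y\<in>quad_vecs. \<Phi> x \<noteq> \<Phi> y \<and> P = vec.span {\<Phi> x + \<Phi> y})" for P
      by blast
    also have "\<dots> P \<longleftrightarrow> P \<in> ?D" for P
      unfolding inj_eq[OF inj\<Phi>] S_def \<Phi>.add by blast
    finally show ?thesis by blast
  qed
  also have "\<dots> = S ` diag_vecs"
  proof (intro equalityI subsetI)
    fix P assume "P \<in> ?D"
    then obtain x y where xy: "P = S (x + y)" "x \<in> quad_vecs" "y \<in> quad_vecs" "x \<noteq> y" by blast
    obtain d where "d \<in> diag_vecs" "x + y = d \<or> x + y = -1 *s d"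
      using quad_vecs_add[OF F xy(2-4)] by blast
    then show "P \<in> S ` diag_vecs" using xy(1) S_scale[of "-1" d] by auto
  next
    fix P assume "P \<in> S ` diag_vecs"
    then obtain d where d: "P = S d" "d \<in> diag_vecs" by blast
    obtain x y where "x \<in> quad_vecs" "y \<in> quad_vecs" "x \<noteq> y" "d = x + y \<or> d = -1 *s (x + y)"
      using diag_vecs_split[OF F d(2)] by blast
    moreover from this have "P = S (x + y)" using d(1) S_scale[of "-1" "x + y"] by auto
    ultimately show "P \<in> ?D" by blast
  qed
  finally have "\<Delta>_inf = S ` diag_vecs"
    by (simp add: assms(4) \<Gamma> S_def[abs_def] image_image)
  then have K: "\<K> = S ` ?T" unfolding assms(5) affine by (simp add: image_Un)
  have inj_T: "inj_on S ?T" using inj_S by (rule inj_on_subset) auto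

  have "card (H \<inter> \<K>) \<in> {0, 3, 6}" if "pg_hyperplane H" for H
  proof -
    obtain V where V: "vec.subspace V" "vec.dim V + 1 = CARD(6)" "H = pg_of V"
      using \<open>pg_hyperplane H\<close> by (auto simp: pg_hyperplane_def)
    obtain c where c: "c \<noteq> 0" "\<And>x. \<Phi> x \<in> V \<longleftrightarrow> (\<Sum>i\<in>UNIV. c $ i * x $ i) = 0"
      using hyperplane_vimage[OF V(1,2) \<Phi>] by blast
    have "S t \<in> H \<longleftrightarrow> \<Phi> t \<in> V" if "t \<in> ?T" for t
    proof -
      have "t \<noteq> 0" using that by (auto simp: affine_vec_def diag_vecs_def eq_vec6_iff vector_6)
      then have "S t \<in> pg_points"
        unfolding S_def pg_points_eq using inj\<Phi> \<Phi>.zero by (auto simp: inj_def)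
      moreover have "S t \<subseteq> V \<longleftrightarrow> \<Phi> t \<in> V"
        unfolding S_def using V(1) vec.span_minimal[of "{\<Phi> t}" V] vec.span_base[of "\<Phi> t" "{\<Phi> t}"] by auto
      ultimately show ?thesis by (simp add: V(3) pg_of_def)
    qed
    then have "H \<inter> \<K> = S ` {t \<in> ?T. (\<Sum>i\<in>UNIV. c $ i * t $ i) = 0}"
      unfolding K c(2)[symmetric] by blast
    then have "card (H \<inter> \<K>) = card {t \<in> ?T. (\<Sum>i\<in>UNIV. c $ i * t $ i) = 0}"
      using inj_on_subset[OF inj_T] by (metis (lifting) card_image mem_Collect_eq subsetI)
    then show ?thesis using card_hyperplane_weights[OF F c(1)] by simp
  qed
  moreover have "card \<K> = 12"
    unfolding K card_image[OF inj_T] by (rule card_weights[OF F])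
  ultimately show ?thesis by blast
qed

end
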